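(* Let $\eta\neq0$ and $\ell>-1$ be real, and define $\rho^*=-(\ell+1)(\ell+2)/\eta$. Let $\{x_{\ell,\eta,k}\}_{k\ge1}$ be the set of all zeros of $\phi_{\ell,\eta}$. (i) If $\rho^*\neq x_{\ell,\eta,k}$ for all $k\ge1$, then the zeros of $\phi_{\ell,\eta}(x)$ are interlaced with the zeros of $x(x-\rho^* )\phi_{\ell+2,\eta}(x)$. (ii) If $\rho^*=x_{\ell,\eta,k}$ for some $k\ge1$, then the zeros of $\phi_{\ell,\eta}(x)/(x-\rho^* )$ are interlaced with the zeros of $x\phi_{\ell+2,\eta}(x)$.
   Context: For real $\eta$ and $\ell>-1$, $$\phi_{\ell,\eta}(x)=e^{-ix}\,{}_1F_1(\ell+1-i\eta,\,2\ell+2;\,2ix),\qquad {}_1F_1(a,b;z)=\sum_{k\ge0}\frac{(a)_k}{(b)_k}\frac{z^k}{k!},$$ where $(a)_k=\Gamma(a+k)/\Gamma(a)$; this is an entire function of $x$, real-valued on $\mathbb{R}$, and it is known that all its zeros are real and simple. The zeros of two functions are interlaced if the functions have no common zero and between any two consecutive (real) zeros of either one there is exactly one zero of the other. *)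

theory Defs
  imports "HOL-Complex_Analysis.Complex_Analysis"
begin

text \<open>For \<open>a\<close> not a nonpositive integer, \<open>pochhammer a k = Gamma (a + k) / Gamma a\<close>
  (\<open>pochhammer_Gamma\<close>).\<close>
definition hyp1F1 :: "complex \<Rightarrow> complex \<Rightarrow> complex \<Rightarrow> complex" where
  "hyp1F1 a b z = (\<Sum>k. pochhammer a k / pochhammer b k * (z ^ k / fact k))"

definition coulomb_phi :: "real \<Rightarrow> real \<Rightarrow> complex \<Rightarrow> complex" where
  "coulomb_phi l \<eta> x =
     exp (- \<i> * x) * hyp1F1 (of_real l + 1 - \<i> * of_real \<eta>) (2 * of_real l + 2) (2 * \<i> * x)"

definition zeros :: "(complex \<Rightarrow> complex) \<Rightarrow> complex set" where
  "zeros f = {z. f z = 0}"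

definition consecutive_zeros :: "(complex \<Rightarrow> complex) \<Rightarrow> real \<Rightarrow> real \<Rightarrow> bool" where
  "consecutive_zeros f a b \<longleftrightarrow>
     a < b \<and> of_real a \<in> zeros f \<and> of_real b \<in> zeros f \<and> (\<forall>t\<in>{a<..<b}. of_real t \<notin> zeros f)"

text \<open>Common zeros are excluded in the whole complex plane; consecutiveness only makes sense
  for the real zeros, and zeros are counted without multiplicity.\<close>
definition interlaced_zeros :: "(complex \<Rightarrow> complex) \<Rightarrow> (complex \<Rightarrow> complex) \<Rightarrow> bool" where
  "interlaced_zeros f g \<longleftrightarrow>
     zeros f \<inter> zeros g = {} \<and>
     (\<forall>a b. consecutive_zeros f a b \<longrightarrow> (\<exists>!t. t \<in> {a<..<b} \<and> of_real t \<in> zeros g)) \<and>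
     (\<forall>a b. consecutive_zeros g a b \<longrightarrow> (\<exists>!t. t \<in> {a<..<b} \<and> of_real t \<in> zeros f))"

text \<open>The function \<open>f x / (x - r)\<close>, for \<open>r\<close> a zero of an entire \<open>f\<close>, is again entire. As
  division by zero yields zero in HOL, the plain quotient would have a spurious zero at \<open>r\<close>, so
  the removable singularity is filled in by the limit.\<close>
definition divide_root :: "(complex \<Rightarrow> complex) \<Rightarrow> complex \<Rightarrow> complex \<Rightarrow> complex" where
  "divide_root f r = remove_sings (\<lambda>x. f x / (x - r))"

end

theory Submission
  imports Defs
begin

text \<open>Write \<open>p, q, r\<close> for the Coulomb functions with parameters \<open>l, l + 1, l + 2\<close>. The contiguous
  relations of Kummer's function give a first-order system with real coefficients,

    \<open>p' = \<alpha> p - \<kappa> x q\<close>  and  \<open>x q' = (2 l + 3) (p - q) - \<alpha> x q\<close>  with  \<open>\<alpha> = \<eta> / (l + 1)\<close>,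
    \<open>(2 l + 3) \<kappa> = 1 + \<alpha>\<^sup>2\<close>.

  It determines the Taylor coefficients at 0, so the functions are real on the real line; away
  from 0 it is regular, so \<open>p\<close> and \<open>q\<close> have no common zero; and used for \<open>l\<close> and for \<open>l + 1\<close> it
  yields the three-term recurrence \<open>p = \<tau> q - K x\<^sup>2 r\<close>, where \<open>K > 0\<close> and
  \<open>\<tau> = 1 + \<eta> x / ((l + 1) (l + 2)) = 1 - x / \<rho>\<close>.

  Two functions without common zeros interlace as soon as their Wronskian keeps its sign, because
  their quotient is then strictly monotone between its poles (\<open>interlaced_zerosI\<close>). The Wronskian
  of \<open>p\<close> and \<open>x \<tau> r\<close> turns out to be a sum of two nonnegative terms:

    \<open>(x \<tau> r)' p - x \<tau> r p' = \<tau>\<^sup>2 ((x r)' q - x r q') + K (x r)\<^sup>2\<close>.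

  The bracket is the Wronskian of a neighbouring pair; it is positive on the whole real line
  (\<open>wronskian_pos\<close>). So the left-hand side is positive except possibly at \<open>\<rho>\<close>, and
  \<open>x \<tau> r\<close> is a constant multiple of \<open>x (x - \<rho>) r\<close>. By the recurrence, a common zero of
  \<open>p\<close> and \<open>r\<close> must be a zero of \<open>\<tau>\<close>, hence equal to \<open>\<rho>\<close>. If \<open>\<rho>\<close> is a zero of
  \<open>p\<close>, the factor \<open>x - \<rho>\<close> is removed from both functions, which divides their Wronskian
  by \<open>(x - \<rho>)\<^sup>2\<close> and keeps its sign.\<close>

section \<open>Contiguous relations of the Kummer function\<close>

text \<open>The series in \<open>z\<close> of \<open>hyp1F1 a b (c * z)\<close>. The scaling \<open>c\<close> is built in so that the
  derivative in \<open>z\<close> is the formal derivative.\<close>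
definition kummer_fps :: "complex \<Rightarrow> complex \<Rightarrow> complex \<Rightarrow> complex fps" where
  "kummer_fps a b c = Abs_fps (\<lambda>k. pochhammer a k / pochhammer b k * (c ^ k / fact k))"

lemma conv_radius_kummer_fps [simp]: "fps_conv_radius (kummer_fps a b c) = \<infinity>"
proof -
  have "summable (\<lambda>k. fps_nth (kummer_fps a b c) k * z ^ k)" for z :: complex
  proof -
    let ?u = "\<lambda>k. fps_nth (kummer_fps a b c) k * z ^ k"
    obtain N :: nat where N: "real N \<ge> max 1 (max (norm a) (max (2 * norm b) (8 * norm (c * z))))"
      using real_arch_simple by blast
    have "norm (?u (Suc k)) \<le> (1/2) * norm (?u k)" if "N \<le> k" for k
    proof -
      have k: "real k \<ge> 1" "real k \<ge> norm a" "real k \<ge> 2 * norm b" "real k \<ge> 8 * norm (c * z)"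
        using N that by linarith+
      \<comment> \<open>Also true if \<open>b + k = 0\<close>: then both sides vanish because \<open>1 / 0 = 0\<close>.\<close>
      have step: "?u (Suc k) = ?u k * ((a + of_nat k) / (b + of_nat k) * (c * z) / of_nat (Suc k))"
        by (simp add: kummer_fps_def pochhammer_Suc divide_simps)
      have top: "norm (a + of_nat k) \<le> 2 * real k"
        using norm_triangle_ineq[of a "of_nat k"] k by simp
      have bot: "norm (b + of_nat k) \<ge> real k / 2"
        using norm_triangle_ineq2[of "of_nat k" "- b"] k by (simp add: add.commute)
      have "norm ((a + of_nat k) / (b + of_nat k)) \<le> (2 * real k) / (real k / 2)"
        unfolding norm_divide using top bot k by (intro frac_le) auto
      also have "\<dots> = 4"
        using k by simp
      finally have "norm ((a + of_nat k) / (b + of_nat k)) * (norm (c * z) / real (Suc k))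
          \<le> 4 * (norm (c * z) / real (Suc k))"
        by (intro mult_right_mono) auto
      also have "\<dots> \<le> 1/2"
        using k by (simp add: field_simps)
      finally have "norm ((a + of_nat k) / (b + of_nat k) * (c * z) / of_nat (Suc k)) \<le> 1/2"
        by (simp add: norm_mult norm_divide del: of_nat_Suc)
      thus ?thesis
        unfolding step norm_mult[of "?u k"]
        by (metis mult.commute mult_left_mono norm_ge_zero)
    qed
    thus ?thesis
      by (intro summable_ratio_test[of "1/2" N]) auto
  qed
  thus ?thesis
    unfolding fps_conv_radius_def by (intro conv_radius_inftyI'') auto
qed

lemma eval_kummer_fps: "eval_fps (kummer_fps a b c) z = hyp1F1 a b (c * z)"
  by (simp add: eval_fps_def kummer_fps_def hyp1F1_def power_mult_distrib mult_ac)

lemma kummer_fps_coeff_Suc: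
  "fps_nth (kummer_fps a b c) (Suc k) * of_nat (Suc k)
     = c * (a + of_nat k) / (b + of_nat k) * fps_nth (kummer_fps a b c) k"
  by (simp add: kummer_fps_def pochhammer_Suc divide_simps del: of_nat_Suc)

text \<open>Raising \<open>(a, b)\<close> to \<open>(a + 1, b + 2)\<close> shifts the two Pochhammer symbols against each other by
  one and two steps, so neighbouring coefficients of the two series differ by a rational factor.
  This factor reduces each contiguous relation below to an identity between rational functions.\<close>
lemma kummer_fps_coeff_shift:
  assumes b: "\<And>k. b + of_nat k \<noteq> 0"
  shows "of_nat (Suc k) * fps_nth (kummer_fps a b c) (Suc k)
     = c * a * (b + of_nat (Suc k)) / (b * (b + 1)) * fps_nth (kummer_fps (a + 1) (b + 2) c) k"
proof -
  have eq: "pochhammer b (Suc k) * (b + of_nat (Suc k)) = b * (b + 1) * pochhammer (b + 2) k"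
    using pochhammer_rec[of b "Suc k"] pochhammer_rec[of "b + 1" k] pochhammer_Suc[of b "Suc k"]
    by (simp add: add_ac)
  have nz: "pochhammer b (Suc k) \<noteq> 0" "pochhammer (b + 2) k \<noteq> 0"
    using b b[of "k + 2" for k] by (auto simp: pochhammer_eq_0_iff eq_neg_iff_add_eq_0 add_ac)
  have b01: "b \<noteq> 0" "b + 1 \<noteq> 0"
    using b[of 0] b[of 1] by auto
  have inv: "1 / pochhammer b (Suc k)
      = (b + of_nat (Suc k)) / (b * (b + 1) * pochhammer (b + 2) k)"
    using eq nz b01 by (simp add: divide_simps del: of_nat_Suc) (simp add: mult.commute)
  have "of_nat (Suc k) * fps_nth (kummer_fps a b c) (Suc k)
      = a * pochhammer (a + 1) k * (1 / pochhammer b (Suc k)) * (c * c ^ k / fact k)"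
    unfolding kummer_fps_def
    by (simp add: pochhammer_rec[of a k] divide_simps del: of_nat_Suc)
  thus ?thesis
    unfolding inv by (simp add: kummer_fps_def mult_ac)
qed

text \<open>The two contiguous relations of Kummer's function that step between \<open>(a, b)\<close> and
  \<open>(a + 1, b + 2)\<close>, that is between \<open>l\<close> and \<open>l + 1\<close> for the Coulomb functions. Together they form
  a first-order system for the pair.\<close>
lemma kummer_fps_contiguous_lower:
  assumes b: "\<And>k. b + of_nat k \<noteq> 0"
  shows "fps_deriv (kummer_fps a b c) = fps_const (c * a / b) * kummer_fps a b c
     + fps_const (c\<^sup>2 * a * (b - a) / (b\<^sup>2 * (b + 1))) * (fps_X * kummer_fps (a + 1) (b + 2) c)"
    (is "?l = ?r")
proof (rule fps_ext)
  fix k :: nat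
  let ?m = "fps_nth (kummer_fps a b c)" and ?n = "fps_nth (kummer_fps (a + 1) (b + 2) c)"
  have bb: "b \<noteq> 0" "b + 1 \<noteq> 0" "b + of_nat k \<noteq> 0"
    using b[of 0] b[of 1] b[of k] by auto
  have l: "fps_nth ?l k = c * (a + of_nat k) / (b + of_nat k) * ?m k"
    using kummer_fps_coeff_Suc[of a b c k] by (simp add: mult.commute)
  show "fps_nth ?l k = fps_nth ?r k"
  proof (cases k)
    case 0
    thus ?thesis unfolding l by (simp add: bb)
  next
    case (Suc j)
    have "(of_nat k * ?m k) * ((c * (b - a)) / (b * (b + of_nat k)))
        = (c * a * (b + of_nat k) / (b * (b + 1)) * ?n j) * ((c * (b - a)) / (b * (b + of_nat k)))"
      using kummer_fps_coeff_shift[OF b, of j a c] Suc by simp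
    also have "\<dots> = c\<^sup>2 * a * (b - a) / (b\<^sup>2 * (b + 1)) * ?n j"
      using bb by (simp add: divide_simps power2_eq_square)
    finally have n: "c\<^sup>2 * a * (b - a) / (b\<^sup>2 * (b + 1)) * ?n j
        = (of_nat k * ?m k) * ((c * (b - a)) / (b * (b + of_nat k)))" ..
    have fr: "c * (a + of_nat k) / (b + of_nat k)
        = c * a / b + of_nat k * ((c * (b - a)) / (b * (b + of_nat k)))"
      using bb by (simp add: divide_simps) (simp add: algebra_simps)
    have "fps_nth ?r k = c * a / b * ?m k + c\<^sup>2 * a * (b - a) / (b\<^sup>2 * (b + 1)) * ?n j"
      using Suc by simp
    thus ?thesis
      unfolding l n fr by (simp add: algebra_simps)
  qed
qed

lemma kummer_fps_contiguous_upper: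
  assumes b: "\<And>k. b + of_nat k \<noteq> 0"
  shows "fps_X * fps_deriv (kummer_fps (a + 1) (b + 2) c)
     = fps_const (b + 1) * (kummer_fps a b c - kummer_fps (a + 1) (b + 2) c)
     + fps_const (c * (1 - a / b)) * (fps_X * kummer_fps (a + 1) (b + 2) c)"
    (is "?l = ?r")
proof (rule fps_ext)
  fix k :: nat
  let ?m = "fps_nth (kummer_fps a b c)" and ?n = "fps_nth (kummer_fps (a + 1) (b + 2) c)"
  show "fps_nth ?l k = fps_nth ?r k"
  proof (cases k)
    case 0
    thus ?thesis by (simp add: kummer_fps_def)
  next
    case (Suc j)
    define t :: complex where "t = of_nat k"
    have "t \<noteq> 0"
      using Suc by (simp add: t_def del: of_nat_Suc)
    with b have bb: "b \<noteq> 0" "b + 1 \<noteq> 0" "b + t \<noteq> 0" "b + 1 + t \<noteq> 0" "t \<noteq> 0"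
      using b[of 0] b[of 1] b[of k] b[of "Suc k"] Suc by (auto simp: t_def add_ac)
    have m: "?m k = c * a * (b + t) / (b * (b + 1)) * ?n j / t"
      using kummer_fps_coeff_shift[OF b, of j a c] Suc bb by (simp add: t_def divide_simps mult_ac)
    have "?n k * t = c * (a + t) / (b + 1 + t) * ?n j"
      using kummer_fps_coeff_Suc[of "a + 1" "b + 2" c j] Suc by (simp add: t_def add_ac)
    hence n: "?n k = c * (a + t) / (b + 1 + t) * ?n j / t"
      using bb by (simp add: divide_simps) (simp add: mult_ac)
    have "(b + 1 + t) * ?n k = (b + 1) * ?m k + c * (1 - a / b) * ?n j"
      unfolding m n using bb by (simp add: divide_simps) (simp add: algebra_simps)
    thus ?thesis
      using Suc by (simp add: t_def algebra_simps)
  qed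
qed

section \<open>The first-order system of the Coulomb functions\<close>

definition coulomb_fps :: "real \<Rightarrow> real \<Rightarrow> complex fps" where
  "coulomb_fps l \<eta> = fps_exp (- \<i>) *
     kummer_fps (of_real l + 1 - \<i> * of_real \<eta>) (2 * of_real l + 2) (2 * \<i>)"

text \<open>The factor \<open>\<kappa>\<close> of the system: minus this number is the coefficient with which \<open>x\<close> times the
  function for \<open>l + 1\<close> enters the derivative of the one for \<open>l\<close>. It equals
  \<open>((l + 1)\<^sup>2 + \<eta>\<^sup>2) / ((l + 1)\<^sup>2 (2 l + 3))\<close>.\<close>
definition coulomb_coeff :: "real \<Rightarrow> real \<Rightarrow> real" where
  "coulomb_coeff l \<eta> = (1 + (\<eta> / (l + 1))\<^sup>2) / (2 * l + 3)"

lemma conv_radius_coulomb_fps [simp]: "fps_conv_radius (coulomb_fps l \<eta>) = \<infinity>"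
  using fps_conv_radius_mult[of "fps_exp (- \<i>)" "kummer_fps (of_real l + 1 - \<i> * of_real \<eta>) (2 * of_real l + 2) (2 * \<i>)"]
  by (simp add: coulomb_fps_def)

lemma coulomb_phi_eq_eval_fps: "coulomb_phi l \<eta> z = eval_fps (coulomb_fps l \<eta>) z"
  by (simp add: coulomb_fps_def coulomb_phi_def eval_fps_mult eval_kummer_fps)

lemma coulomb_phi_0 [simp]: "coulomb_phi l \<eta> 0 = 1"
  by (simp add: coulomb_phi_eq_eval_fps eval_fps_at_0 coulomb_fps_def kummer_fps_def)

lemma holomorphic_coulomb_phi: "coulomb_phi l \<eta> holomorphic_on A"
  unfolding coulomb_phi_eq_eval_fps[abs_def] by (intro holomorphic_intros) auto

lemma two_l_plus_two_add_nat_neq_0: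
  assumes "l > -1"
  shows "2 * of_real l + 2 + of_nat k \<noteq> (0 :: complex)"
proof
  assume "2 * of_real l + 2 + of_nat k = (0 :: complex)"
  hence "Re (2 * of_real l + 2 + of_nat k) = 0"
    by simp
  thus False using assms by simp
qed

text \<open>In the contiguous relations the imaginary parts of the coefficients are cancelled by the
  derivative of the factor \<open>exp (- \<i> x)\<close>, which leaves a system with real coefficients.\<close>
lemma coulomb_fps_deriv:
  assumes l: "l > -1"
  shows "fps_deriv (coulomb_fps l \<eta>) = fps_const (of_real (\<eta> / (l + 1))) * coulomb_fps l \<eta>
    - fps_const (of_real (coulomb_coeff l \<eta>)) * (fps_X * coulomb_fps (l + 1) \<eta>)"
proof -
  define a b :: complex where "a = of_real l + 1 - \<i> * of_real \<eta>" and "b = 2 * of_real l + 2"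
  define M N where "M = kummer_fps a b (2 * \<i>)" and "N = kummer_fps (a + 1) (b + 2) (2 * \<i>)"
  have phi: "coulomb_fps l \<eta> = fps_exp (- \<i>) * M" "coulomb_fps (l + 1) \<eta> = fps_exp (- \<i>) * N"
    by (simp_all add: coulomb_fps_def M_def N_def a_def b_def algebra_simps)
  have nz: "complex_of_real l + 1 \<noteq> 0" "2 * complex_of_real l + 3 \<noteq> 0"
    using l by (auto simp: complex_eq_iff)
  have ab: "a = of_real (l + 1) - \<i> * of_real \<eta>" "b = 2 * of_real (l + 1)"
    by (simp_all add: a_def b_def)
  have c1: "2 * \<i> * a / b = of_real (\<eta> / (l + 1)) + \<i>"
    unfolding ab of_real_divide using l
    by (simp add: divide_simps del: of_real_add) (simp add: algebra_simps)
  have c2: "(2 * \<i>)\<^sup>2 * a * (b - a) / (b\<^sup>2 * (b + 1)) = - of_real (coulomb_coeff l \<eta>)"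
  proof -
    define x y :: complex where "x = (of_real l + 1)\<^sup>2 + (of_real \<eta>)\<^sup>2"
      and "y = (of_real l + 1)\<^sup>2 * (2 * of_real l + 3)"
    have "a * (b - a) = x" "b\<^sup>2 * (b + 1) = 4 * y" "(2 * \<i>)\<^sup>2 = -4"
      by (simp_all add: a_def b_def x_def y_def power2_eq_square algebra_simps)
    moreover have "of_real (coulomb_coeff l \<eta>) = x / y"
      unfolding coulomb_coeff_def x_def y_def using nz by (simp add: power_divide add_divide_distrib)
    ultimately show ?thesis
      by (simp add: mult.assoc)
  qed
  define s J k :: "complex fps" where "s = fps_const (of_real (\<eta> / (l + 1)))"
    and "J = fps_const \<i>" and "k = fps_const (of_real (coulomb_coeff l \<eta>))"
  have J: "fps_const (- \<i>) = - J"
    by (simp add: J_def)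
  have "fps_deriv M = fps_const (2 * \<i> * a / b) * M
      + fps_const ((2 * \<i>)\<^sup>2 * a * (b - a) / (b\<^sup>2 * (b + 1))) * (fps_X * N)"
    unfolding M_def N_def b_def
    by (rule kummer_fps_contiguous_lower) (rule two_l_plus_two_add_nat_neq_0[OF l])
  hence dM: "fps_deriv M = (s + J) * M - k * (fps_X * N)"
    unfolding c1 c2 by (simp add: s_def J_def k_def flip: fps_const_neg)
  thus ?thesis
    unfolding phi s_def[symmetric] k_def[symmetric] by (simp add: J dM algebra_simps)
qed

lemma coulomb_fps_deriv_Suc:
  assumes l: "l > -1"
  shows "fps_X * fps_deriv (coulomb_fps (l + 1) \<eta>)
    = fps_const (of_real (2 * l + 3)) * (coulomb_fps l \<eta> - coulomb_fps (l + 1) \<eta>)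
    - fps_const (of_real (\<eta> / (l + 1))) * (fps_X * coulomb_fps (l + 1) \<eta>)"
proof -
  define a b :: complex where "a = of_real l + 1 - \<i> * of_real \<eta>" and "b = 2 * of_real l + 2"
  define M N where "M = kummer_fps a b (2 * \<i>)" and "N = kummer_fps (a + 1) (b + 2) (2 * \<i>)"
  have phi: "coulomb_fps l \<eta> = fps_exp (- \<i>) * M" "coulomb_fps (l + 1) \<eta> = fps_exp (- \<i>) * N"
    by (simp_all add: coulomb_fps_def M_def N_def a_def b_def algebra_simps)
  have ab: "a = of_real (l + 1) - \<i> * of_real \<eta>" "b = 2 * of_real (l + 1)"
    by (simp_all add: a_def b_def)
  have c1: "2 * \<i> * (1 - a / b) = \<i> - of_real (\<eta> / (l + 1))"
    unfolding ab of_real_divide using l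
    by (simp add: divide_simps del: of_real_add) (simp add: algebra_simps)
  have c2: "b + 1 = of_real (2 * l + 3)"
    by (simp add: b_def)
  define s J m :: "complex fps" where "s = fps_const (of_real (\<eta> / (l + 1)))"
    and "J = fps_const \<i>" and "m = fps_const (of_real (2 * l + 3))"
  have J: "fps_const (- \<i>) = - J"
    by (simp add: J_def)
  have "fps_X * fps_deriv N = fps_const (b + 1) * (M - N) + fps_const (2 * \<i> * (1 - a / b)) * (fps_X * N)"
    unfolding M_def N_def b_def
    by (rule kummer_fps_contiguous_upper) (rule two_l_plus_two_add_nat_neq_0[OF l])
  hence "fps_X * fps_deriv N = m * (M - N) + (J - s) * (fps_X * N)"
    unfolding c1 c2 by (simp add: s_def J_def m_def)
  hence "fps_exp (- \<i>) * (fps_X * fps_deriv N) = fps_exp (- \<i>) * (m * (M - N) + (J - s) * (fps_X * N))"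
    by simp
  thus ?thesis
    unfolding phi s_def[symmetric] m_def[symmetric] by (simp add: J algebra_simps)
qed

text \<open>The system determines the coefficients of both series recursively from the common constant
  term 1, and all its constants are real. The coefficient of \<open>z ^ k\<close> for \<open>l + 1\<close> is found by
  division by \<open>k + 2 l + 3 > 0\<close>.\<close>
lemma coulomb_fps_real:
  assumes l: "l > -1"
  shows "fps_nth (coulomb_fps l \<eta>) k \<in> \<real>"
proof -
  let ?p = "fps_nth (coulomb_fps l \<eta>)" and ?q = "fps_nth (coulomb_fps (l + 1) \<eta>)"
  have "?p k \<in> \<real> \<and> ?q k \<in> \<real>"
  proof (induction k rule: less_induct)
    case (less k)
    show ?case
    proof (cases k)
      case 0
      thus ?thesis by (simp add: coulomb_fps_def kummer_fps_def)
    next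
      case (Suc j)
      have IH: "?p j \<in> \<real>" "?q j \<in> \<real>" "j \<ge> 1 \<Longrightarrow> ?q (j - 1) \<in> \<real>"
        using less[of j] less[of "j - 1"] Suc by auto
      have "of_nat k * ?p k = of_real (\<eta> / (l + 1)) * ?p j
          - of_real (coulomb_coeff l \<eta>) * (if j = 0 then 0 else ?q (j - 1))"
        using arg_cong[OF coulomb_fps_deriv[OF l, of \<eta>], of "\<lambda>F. fps_nth F j"] Suc by simp
      also have "\<dots> \<in> \<real>"
        using IH by (auto intro!: Reals_diff Reals_mult Reals_divide)
      finally have "of_nat k * ?p k / of_nat k \<in> \<real>"
        by (intro Reals_divide) auto
      hence p: "?p k \<in> \<real>"
        using Suc by (simp del: of_nat_Suc)
      have "of_nat k * ?q k = of_real (2 * l + 3) * (?p k - ?q k) - of_real (\<eta> / (l + 1)) * ?q j"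
        using arg_cong[OF coulomb_fps_deriv_Suc[OF l, of \<eta>], of "\<lambda>F. fps_nth F k"] Suc
        by simp
      hence "of_real (real k + (2 * l + 3)) * ?q k
          = of_real (2 * l + 3) * ?p k - of_real (\<eta> / (l + 1)) * ?q j"
        by (simp add: algebra_simps)
      also have "\<dots> \<in> \<real>"
        using IH p by (intro Reals_diff Reals_mult Reals_of_real)
      finally have "of_real (real k + (2 * l + 3)) * ?q k / of_real (real k + (2 * l + 3)) \<in> \<real>"
        by (intro Reals_divide) auto
      moreover have "complex_of_real (real k + (2 * l + 3)) \<noteq> 0"
        unfolding of_real_eq_0_iff using l by linarith
      ultimately have "?q k \<in> \<real>"
        by (simp del: of_real_add of_real_mult)
      with p show ?thesis ..
    qed
  qed
  thus ?thesis ..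
qed

lemma coulomb_phi_real:
  assumes l: "l > -1"
  shows "coulomb_phi l \<eta> (of_real x) = of_real (Re (coulomb_phi l \<eta> (of_real x)))"
proof -
  let ?t = "\<lambda>k. fps_nth (coulomb_fps l \<eta>) k * of_real x ^ k"
  have "Im (?t k) = 0" for k
    using coulomb_fps_real[OF l, of \<eta> k]
    by (auto elim!: Reals_cases simp flip: of_real_power of_real_mult)
  hence "(\<Sum>k. Im (?t k)) = 0"
    by (simp only: suminf_zero)
  moreover have "Im (\<Sum>k. ?t k) = (\<Sum>k. Im (?t k))"
    by (rule bounded_linear.suminf[OF bounded_linear_Im]) (auto intro!: summable_fps)
  ultimately have "Im (coulomb_phi l \<eta> (of_real x)) = 0"
    by (simp only: coulomb_phi_eq_eval_fps eval_fps_def)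
  thus ?thesis
    by (simp add: complex_eq_iff)
qed

text \<open>The derivative is represented by the right-hand side of the system, which is the form in which
  it is combined with the other functions.\<close>
definition coulomb_phi_deriv :: "real \<Rightarrow> real \<Rightarrow> complex \<Rightarrow> complex" where
  "coulomb_phi_deriv l \<eta> z = of_real (\<eta> / (l + 1)) * coulomb_phi l \<eta> z
     - of_real (coulomb_coeff l \<eta>) * z * coulomb_phi (l + 1) \<eta> z"

lemma eval_coulomb_fps_deriv:
  assumes l: "l > -1"
  shows "eval_fps (fps_deriv (coulomb_fps l \<eta>)) z = coulomb_phi_deriv l \<eta> z"
proof -
  have cr: "fps_conv_radius (fps_const c * coulomb_fps l \<eta>) = \<infinity>"
     "fps_conv_radius (fps_X * coulomb_fps l \<eta>) = \<infinity>"
     "fps_conv_radius (fps_const c * (fps_X * coulomb_fps l \<eta>)) = \<infinity>" for c l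
    using fps_conv_radius_mult[of "fps_const c" "coulomb_fps l \<eta>"]
      fps_conv_radius_mult[of "fps_X" "coulomb_fps l \<eta>"]
      fps_conv_radius_mult[of "fps_const c" "fps_X * coulomb_fps l \<eta>"] by auto
  show ?thesis
    unfolding coulomb_fps_deriv[OF l] coulomb_phi_deriv_def
    by (simp add: eval_fps_diff eval_fps_mult cr coulomb_phi_eq_eval_fps mult.assoc)
qed

lemma coulomb_phi_has_derivative:
  assumes l: "l > -1"
  shows "(coulomb_phi l \<eta> has_field_derivative coulomb_phi_deriv l \<eta> z) (at z)"
proof -
  have "coulomb_phi l \<eta> = eval_fps (coulomb_fps l \<eta>)"
    by (rule ext) (rule coulomb_phi_eq_eval_fps)
  thus ?thesis
    using has_field_derivative_eval_fps[of z "coulomb_fps l \<eta>" UNIV]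
    by (simp add: eval_coulomb_fps_deriv[OF l])
qed

lemma coulomb_phi_deriv_Suc:
  assumes l: "l > -1"
  shows "z * coulomb_phi_deriv (l + 1) \<eta> z
    = of_real (2 * l + 3) * (coulomb_phi l \<eta> z - coulomb_phi (l + 1) \<eta> z)
    - of_real (\<eta> / (l + 1)) * z * coulomb_phi (l + 1) \<eta> z"
proof -
  have "fps_conv_radius (fps_X * coulomb_fps l \<eta>) = \<infinity>" for l
    using fps_conv_radius_mult[of "fps_X" "coulomb_fps l \<eta>"] by auto
  moreover have "fps_conv_radius (fps_const c * (fps_X * coulomb_fps l \<eta>)) = \<infinity>" for l c
    using fps_conv_radius_mult[of "fps_const c" "fps_X * coulomb_fps l \<eta>"] calculation[of l] by auto
  moreover have "fps_conv_radius (coulomb_fps l \<eta> - coulomb_fps (l + 1) \<eta>) = \<infinity>"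
    using fps_conv_radius_diff[of "coulomb_fps l \<eta>" "coulomb_fps (l + 1) \<eta>"] by auto
  moreover have "fps_conv_radius (fps_const c * (coulomb_fps l \<eta> - coulomb_fps (l + 1) \<eta>)) = \<infinity>" for c
    using fps_conv_radius_mult[of "fps_const c" "coulomb_fps l \<eta> - coulomb_fps (l + 1) \<eta>"] calculation by auto
  moreover have "fps_conv_radius (fps_deriv (coulomb_fps (l + 1) \<eta>)) = \<infinity>"
    using fps_conv_radius_deriv[of "coulomb_fps (l + 1) \<eta>"] by auto
  ultimately show ?thesis
    using arg_cong[OF coulomb_fps_deriv_Suc[OF l, of \<eta>], of "\<lambda>F. eval_fps F z"] l
    by (simp add: eval_fps_diff eval_fps_mult eval_coulomb_fps_deriv mult.assoc flip: coulomb_phi_eq_eval_fps)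
qed

text \<open>The system for \<open>(l, l + 1)\<close> and the one for \<open>(l + 1, l + 2)\<close> each express the derivative of
  the middle function; equating the two gives the three-term recurrence. The factor on the left
  vanishes, for \<open>\<eta> \<noteq> 0\<close>, exactly at the exceptional point
  \<open>- (l + 1) (l + 2) / \<eta>\<close>.\<close>
lemma coulomb_phi_recurrence:
  assumes l: "l > -1"
  shows "(1 + of_real (\<eta> / ((l + 1) * (l + 2))) * z) * coulomb_phi (l + 1) \<eta> z = coulomb_phi l \<eta> z
    + of_real (coulomb_coeff (l + 1) \<eta> / (2 * l + 3)) * z\<^sup>2 * coulomb_phi (l + 2) \<eta> z"
proof -
  define p q r k where "p = coulomb_phi l \<eta> z" and "q = coulomb_phi (l + 1) \<eta> z"
    and "r = coulomb_phi (l + 2) \<eta> z" and "k = coulomb_coeff (l + 1) \<eta>"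
  define s t m where "s = complex_of_real (\<eta> / (l + 1))" and "t = complex_of_real (\<eta> / (l + 2))"
    and "m = complex_of_real (2 * l + 3)"
  have "z * (t * q - of_real k * z * r) = m * (p - q) - s * z * q"
    using coulomb_phi_deriv_Suc[OF l, of z \<eta>]
    by (simp add: coulomb_phi_deriv_def p_def q_def r_def k_def s_def t_def m_def add_ac)
  hence eq: "(m + (s + t) * z) * q = m * p + of_real k * z\<^sup>2 * r"
    by (simp add: algebra_simps power2_eq_square)
  define u where "u = complex_of_real (\<eta> / ((l + 1) * (l + 2)))"
  have st: "s + t = m * u"
    unfolding s_def t_def m_def u_def of_real_mult[symmetric] of_real_add[symmetric] of_real_eq_iff
    using l by (simp add: field_simps)
  have "m \<noteq> 0"
    unfolding m_def of_real_eq_0_iff using l by linarith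
  hence "(1 + u * z) * q = p + of_real k / m * z\<^sup>2 * r"
    using eq unfolding st by (simp add: divide_simps) (simp add: algebra_simps)
  thus ?thesis
    by (simp add: p_def q_def r_def k_def m_def u_def)
qed

text \<open>Away from 0 the system is regular, so a common zero would be a zero of all derivatives and
  the function would vanish identically, contradicting its value 1 at 0.\<close>
lemma coulomb_phi_no_common_zero:
  assumes l: "l > -1" and p: "coulomb_phi l \<eta> z = 0"
  shows "coulomb_phi (l + 1) \<eta> z \<noteq> 0"
proof
  assume q: "coulomb_phi (l + 1) \<eta> z = 0"
  let ?p = "coulomb_phi l \<eta>" and ?q = "coulomb_phi (l + 1) \<eta>"
  let ?dq = "\<lambda>w. of_real (2 * l + 3) * (?p w - ?q w) / w - of_real (\<eta> / (l + 1)) * ?q w"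
  have z: "z \<noteq> 0"
    using p by auto
  have dq: "(?q has_field_derivative ?dq w) (at w)" if "w \<noteq> 0" for w
  proof -
    have "coulomb_phi_deriv (l + 1) \<eta> w = ?dq w"
      using coulomb_phi_deriv_Suc[OF l, of w \<eta>] that by (simp add: field_simps)
    thus ?thesis
      using coulomb_phi_has_derivative[of "l + 1" \<eta> w] l by simp
  qed
  \<comment> \<open>By the system, every derivative is a combination of the two functions themselves.\<close>
  have rep: "\<exists>A B. A holomorphic_on -{0} \<and> B holomorphic_on -{0} \<and>
      (\<forall>w. w \<noteq> 0 \<longrightarrow> (deriv ^^ n) ?p w = A w * ?p w + B w * ?q w)" for n
  proof (induction n)
    case 0
    show ?case
      by (intro exI[of _ "\<lambda>_. 1"] exI[of _ "\<lambda>_. 0"]) auto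
  next
    case (Suc n)
    then obtain A B where A: "A holomorphic_on -{0}" and B: "B holomorphic_on -{0}"
      and eq: "\<And>w. w \<noteq> 0 \<Longrightarrow> (deriv ^^ n) ?p w = A w * ?p w + B w * ?q w"
      by blast
    define A' where "A' = (\<lambda>w. deriv A w + A w * of_real (\<eta> / (l + 1)) + B w * of_real (2 * l + 3) / w)"
    define B' where "B' = (\<lambda>w. deriv B w - A w * of_real (coulomb_coeff l \<eta>) * w
        - B w * (of_real (2 * l + 3) / w + of_real (\<eta> / (l + 1))))"
    have "A' holomorphic_on -{0}" "B' holomorphic_on -{0}"
      unfolding A'_def B'_def using A B by (auto intro!: holomorphic_intros)
    moreover have "(deriv ^^ Suc n) ?p w = A' w * ?p w + B' w * ?q w" if w: "w \<noteq> 0" for w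
    proof -
      have dA: "(A has_field_derivative deriv A w) (at w)" and dB: "(B has_field_derivative deriv B w) (at w)"
        using A B w by (auto intro!: holomorphic_derivI[of _ "-{0}"])
      have "((\<lambda>w. A w * ?p w + B w * ?q w) has_field_derivative A' w * ?p w + B' w * ?q w) (at w)"
        by (rule derivative_eq_intros dA dB coulomb_phi_has_derivative[OF l] dq[OF w] refl)+
          (use w in \<open>simp add: A'_def B'_def coulomb_phi_deriv_def divide_simps\<close>, simp add: algebra_simps)
      moreover have "eventually (\<lambda>w. (deriv ^^ n) ?p w = A w * ?p w + B w * ?q w) (nhds w)"
        using w by (intro eventually_mono[OF eventually_nhds_in_open[of "-{0}" w]]) (auto simp: eq)
      ultimately have "((deriv ^^ n) ?p has_field_derivative A' w * ?p w + B' w * ?q w) (at w)"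
        by (subst DERIV_cong_ev[OF refl _ refl])
      thus ?thesis
        by (simp add: DERIV_imp_deriv)
    qed
    ultimately show ?case by blast
  qed
  have "(deriv ^^ n) ?p z = 0" for n
  proof -
    obtain A B where "(deriv ^^ n) ?p z = A z * ?p z + B z * ?q z"
      using rep[of n] z by blast
    thus ?thesis by (simp add: p q)
  qed
  hence "?p 0 = 0"
    by (rule holomorphic_fun_eq_0_on_connected[OF holomorphic_coulomb_phi open_UNIV connected_UNIV]) simp_all
  thus False by simp
qed

section \<open>Positivity of the Wronskian of a neighbouring pair\<close>

text \<open>The expression \<open>V = q p + x (q' p - q p')\<close> is the Wronskian of \<open>p\<close> and \<open>x q\<close>. The system
  turns it into a quadratic form in \<open>p\<close> and \<open>q\<close> that is indefinite near the origin, so its sign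
  cannot be read off pointwise. What helps is the relation \<open>x V' + 2 L V = 2 L p q\<close>. At a point
  \<open>s > 0\<close> with \<open>V s \<le> 0\<close> the mixed term of the form must outweigh the squares; its factor
  \<open>L + \<alpha> s\<close> must then be positive, since otherwise \<open>L > 0\<close> keeps the discriminant negative. Hence
  \<open>p q > 0\<close> and \<open>V' s > 0\<close>. So \<open>V\<close> cannot reach zero from its positive value at the origin.\<close>
lemma wronskian_pos_right:
  fixes p q p' q' :: "real \<Rightarrow> real" and L \<alpha> \<kappa> :: real
  assumes L: "L > 0" and \<kappa>: "(2 * L + 1) * \<kappa> = 1 + \<alpha>\<^sup>2"
    and dp: "\<And>x. (p has_real_derivative p' x) (at x)"
    and dq: "\<And>x. (q has_real_derivative q' x) (at x)"
    and p': "\<And>x. p' x = \<alpha> * p x - \<kappa> * x * q x"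
    and q': "\<And>x. x * q' x = (2 * L + 1) * (p x - q x) - \<alpha> * x * q x"
    and init: "p 0 = 1" "q 0 = 1"
    and common: "\<And>x. p x = 0 \<Longrightarrow> q x \<noteq> 0"
    and x: "x \<ge> 0"
  shows "0 < q x * p x + x * (q' x * p x - q x * p' x)"
proof -
  define V where "V = (\<lambda>x. (2 * L + 1) * (p x)\<^sup>2 - 2 * (L + \<alpha> * x) * p x * q x + \<kappa> * x\<^sup>2 * (q x)\<^sup>2)"
  have V: "V x = q x * p x + x * (q' x * p x - q x * p' x)" for x
  proof -
    have "q x * p x + x * (q' x * p x - q x * p' x) = q x * p x + (x * q' x) * p x - x * q x * p' x"
      by (simp add: algebra_simps)
    thus ?thesis
      unfolding q' p' V_def by (simp add: power2_eq_square algebra_simps)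
  qed
  define V' where "V' = (\<lambda>x. 2 * (2 * L + 1) * p x * p' x
      - 2 * (\<alpha> * p x * q x + (L + \<alpha> * x) * (p' x * q x + p x * q' x))
      + \<kappa> * (2 * x * (q x)\<^sup>2 + x\<^sup>2 * (2 * q x * q' x)))"
  have dV: "(V has_real_derivative V' x) (at x)" for x
    unfolding V_def V'_def
    by (auto intro!: derivative_eq_intros dp dq simp: power2_eq_square algebra_simps)
  have xV': "x * V' x = 2 * L * p x * q x - 2 * L * V x" for x
  proof -
    have "x * V' x = 2 * (2 * L + 1) * p x * x * p' x
      - 2 * (\<alpha> * x * p x * q x + (L + \<alpha> * x) * (x * p' x * q x + p x * (x * q' x)))
      + \<kappa> * (2 * x\<^sup>2 * (q x)\<^sup>2 + x\<^sup>2 * (2 * q x * (x * q' x)))"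
      by (simp add: V'_def power2_eq_square algebra_simps)
    thus ?thesis
      unfolding q' p' V_def by (simp add: power2_eq_square algebra_simps)
  qed
  have \<kappa>_pos: "\<kappa> > 0"
  proof -
    have "(2 * L + 1) * \<kappa> > 0"
      unfolding \<kappa> by (simp add: add_pos_nonneg)
    thus ?thesis
      using L by (simp add: zero_less_mult_iff)
  qed
  have increasing: "V' s > 0" if s: "s > 0" "V s \<le> 0" for s
  proof -
    have form: "(2 * L + 1) * (p s)\<^sup>2 + \<kappa> * s\<^sup>2 * (q s)\<^sup>2 > 0"
    proof (cases "p s = 0")
      case True
      thus ?thesis using common[of s] s \<kappa>_pos by simp
    next
      case False
      have "(2 * L + 1) * (p s)\<^sup>2 > 0" using False L by simp
      moreover have "\<kappa> * s\<^sup>2 * (q s)\<^sup>2 \<ge> 0" using \<kappa>_pos by simp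
      ultimately show ?thesis by linarith
    qed
    \<comment> \<open>If the factor of the mixed term is \<open>- e \<le> 0\<close>, then \<open>e \<le> - \<alpha> s\<close> because \<open>L > 0\<close>, which
      makes \<open>V s\<close> a positive definite form.\<close>
    have pos: "L + \<alpha> * s > 0"
    proof (rule ccontr)
      assume "\<not> L + \<alpha> * s > 0"
      define e where "e = - (L + \<alpha> * s)"
      have e: "0 \<le> e" "e \<le> - (\<alpha> * s)"
        using \<open>\<not> L + \<alpha> * s > 0\<close> L by (auto simp: e_def)
      hence "e\<^sup>2 \<le> (- (\<alpha> * s))\<^sup>2"
        by (intro power_mono)
      also have "\<dots> < (2 * L + 1) * \<kappa> * s\<^sup>2"
        unfolding \<kappa> using s by (simp add: power_mult_distrib algebra_simps)
      finally have disc: "(2 * L + 1) * \<kappa> * s\<^sup>2 - e\<^sup>2 > 0"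
        by simp
      have "(2 * L + 1) * V s = ((2 * L + 1) * p s + e * q s)\<^sup>2
          + ((2 * L + 1) * \<kappa> * s\<^sup>2 - e\<^sup>2) * (q s)\<^sup>2"
        by (simp add: V_def e_def power2_eq_square algebra_simps)
      also have "\<dots> > 0"
      proof (cases "q s = 0")
        case True
        thus ?thesis using common[of s] L by auto
      next
        case False
        thus ?thesis using disc by (intro add_nonneg_pos) auto
      qed
      finally show False
        using s L by (simp add: zero_less_mult_iff)
    qed
    have "(L + \<alpha> * s) * (2 * (p s * q s)) > 0"
      using form s by (simp add: V_def algebra_simps)
    hence "p s * q s > 0"
      using pos by (simp add: zero_less_mult_iff)
    hence "L * (p s * q s) > 0"
      using L by simp
    moreover have "L * V s \<le> 0"
      using L s by (simp add: mult_nonneg_nonpos)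
    ultimately have "s * V' s > 0"
      unfolding xV' by (simp add: mult.assoc)
    thus ?thesis
      using s by (simp add: zero_less_mult_iff)
  qed
  have "V x > 0"
  proof (rule ccontr)
    assume nonpos: "\<not> V x > 0"
    \<comment> \<open>At the first point where \<open>V \<le> 0\<close> the derivative would be positive, so \<open>V\<close> would be even
      smaller slightly to the left.\<close>
    define S where "S = {0..x} \<inter> V -` {..0}"
    have "closed S"
      unfolding S_def using dV
      by (intro continuous_closed_preimage) (auto intro: DERIV_isCont continuous_at_imp_continuous_on)
    moreover have "bounded S"
      by (rule bounded_subset[of "{0..x}"]) (auto simp: S_def)
    moreover have "S \<noteq> {}"
      using nonpos x by (auto simp: S_def)
    ultimately obtain s where s: "s \<in> S" "\<And>t. t \<in> S \<Longrightarrow> s \<le> t"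
      using compact_attains_inf[of S] by (auto simp: compact_eq_bounded_closed)
    have "V 0 > 0"
      by (simp add: V_def init)
    hence "s > 0" "V s \<le> 0"
      using s(1) by (cases "s = 0"; auto simp: S_def)+
    then obtain d where d: "d > 0" "\<And>h. 0 < h \<Longrightarrow> h < d \<Longrightarrow> V (s - h) < V s"
      using DERIV_pos_inc_left[OF dV increasing] by blast
    define h where "h = min s d / 2"
    have h: "0 < h" "h < d" "h < s"
      using d \<open>s > 0\<close> by (auto simp: h_def)
    hence "s - h \<in> S"
      using d(2)[of h] \<open>V s \<le> 0\<close> s(1) by (auto simp: S_def)
    thus False
      using s(2)[of "s - h"] h by simp
  qed
  thus ?thesis
    by (simp add: V)
qed

text \<open>The reflection \<open>x \<mapsto> - x\<close> preserves the system up to the sign of \<open>\<alpha>\<close>, which extends the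
  bound to the negative half-line.\<close>
lemma wronskian_pos:
  fixes p q p' q' :: "real \<Rightarrow> real" and L \<alpha> \<kappa> :: real
  assumes L: "L > 0" and \<kappa>: "(2 * L + 1) * \<kappa> = 1 + \<alpha>\<^sup>2"
    and dp: "\<And>x. (p has_real_derivative p' x) (at x)"
    and dq: "\<And>x. (q has_real_derivative q' x) (at x)"
    and p': "\<And>x. p' x = \<alpha> * p x - \<kappa> * x * q x"
    and q': "\<And>x. x * q' x = (2 * L + 1) * (p x - q x) - \<alpha> * x * q x"
    and init: "p 0 = 1" "q 0 = 1"
    and common: "\<And>x. p x = 0 \<Longrightarrow> q x \<noteq> 0"
  shows "0 < q x * p x + x * (q' x * p x - q x * p' x)"
proof (cases "x \<ge> 0")
  case True
  thus ?thesis
    using wronskian_pos_right[OF assms] by blast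
next
  case False
  let ?p = "\<lambda>x. p (- x)" and ?q = "\<lambda>x. q (- x)"
    and ?p' = "\<lambda>x. - p' (- x)" and ?q' = "\<lambda>x. - q' (- x)"
  have "0 < ?q (- x) * ?p (- x) + - x * (?q' (- x) * ?p (- x) - ?q (- x) * ?p' (- x))"
  proof (rule wronskian_pos_right[OF L, of \<kappa> "- \<alpha>"])
    show "(?p has_real_derivative ?p' y) (at y)" "(?q has_real_derivative ?q' y) (at y)" for y
      using dp[of "- y"] dq[of "- y"] by (simp_all add: DERIV_mirror)
    show "?p' y = - \<alpha> * ?p y - \<kappa> * y * ?q y" for y
      using p'[of "- y"] by (simp add: algebra_simps)
    show "y * ?q' y = (2 * L + 1) * (?p y - ?q y) - - \<alpha> * y * ?q y" for y
      using q'[of "- y"] by (simp add: algebra_simps)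
  qed (use \<kappa> init common False in auto)
  thus ?thesis
    by (simp add: algebra_simps)
qed

section \<open>Wronskians of the Coulomb functions on the real line\<close>

definition coulomb_re :: "real \<Rightarrow> real \<Rightarrow> real \<Rightarrow> real" where
  "coulomb_re l \<eta> x = Re (coulomb_phi l \<eta> (of_real x))"

definition coulomb_re_deriv :: "real \<Rightarrow> real \<Rightarrow> real \<Rightarrow> real" where
  "coulomb_re_deriv l \<eta> x =
     \<eta> / (l + 1) * coulomb_re l \<eta> x - coulomb_coeff l \<eta> * x * coulomb_re (l + 1) \<eta> x"

lemma coulomb_phi_of_real:
  "l > -1 \<Longrightarrow> coulomb_phi l \<eta> (of_real x) = of_real (coulomb_re l \<eta> x)"
  using coulomb_phi_real[of l \<eta> x] by (simp add: coulomb_re_def)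

lemma coulomb_phi_deriv_of_real:
  "l > -1 \<Longrightarrow> coulomb_phi_deriv l \<eta> (of_real x) = of_real (coulomb_re_deriv l \<eta> x)"
  by (simp add: coulomb_phi_deriv_def coulomb_re_deriv_def coulomb_phi_of_real)

lemma coulomb_re_0 [simp]: "coulomb_re l \<eta> 0 = 1"
  by (simp add: coulomb_re_def)

lemma coulomb_re_has_derivative:
  assumes "l > -1"
  shows "(coulomb_re l \<eta> has_real_derivative coulomb_re_deriv l \<eta> x) (at x)"
  unfolding coulomb_re_def[abs_def]
  using has_field_derivative_Re[OF has_vector_derivative_real_field[OF
      coulomb_phi_has_derivative[OF assms, of \<eta> "of_real x"], of UNIV]]
  by (simp add: coulomb_phi_deriv_of_real[OF assms])

lemma coulomb_re_deriv_Suc: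
  assumes "l > -1"
  shows "x * coulomb_re_deriv (l + 1) \<eta> x
    = (2 * l + 3) * (coulomb_re l \<eta> x - coulomb_re (l + 1) \<eta> x)
      - \<eta> / (l + 1) * x * coulomb_re (l + 1) \<eta> x"
proof -
  have "complex_of_real (x * coulomb_re_deriv (l + 1) \<eta> x)
      = of_real ((2 * l + 3) * (coulomb_re l \<eta> x - coulomb_re (l + 1) \<eta> x)
          - \<eta> / (l + 1) * x * coulomb_re (l + 1) \<eta> x)"
    using coulomb_phi_deriv_Suc[OF assms, of "of_real x" \<eta>] assms
    by (simp add: coulomb_phi_of_real coulomb_phi_deriv_of_real)
  thus ?thesis
    unfolding of_real_eq_iff .
qed

lemma coulomb_re_recurrence:
  assumes "l > -1"
  shows "coulomb_re l \<eta> x = (1 + \<eta> / ((l + 1) * (l + 2)) * x) * coulomb_re (l + 1) \<eta> x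
    - coulomb_coeff (l + 1) \<eta> / (2 * l + 3) * x\<^sup>2 * coulomb_re (l + 2) \<eta> x"
proof -
  have "complex_of_real ((1 + \<eta> / ((l + 1) * (l + 2)) * x) * coulomb_re (l + 1) \<eta> x)
      = of_real (coulomb_re l \<eta> x
          + coulomb_coeff (l + 1) \<eta> / (2 * l + 3) * x\<^sup>2 * coulomb_re (l + 2) \<eta> x)"
    using coulomb_phi_recurrence[OF assms, of \<eta> "of_real x"] assms
    by (simp add: coulomb_phi_of_real)
  thus ?thesis
    unfolding of_real_eq_iff by simp
qed

lemma coulomb_coeff_pos:
  assumes "l > -1"
  shows "coulomb_coeff l \<eta> > 0"
proof -
  have "1 + (\<eta> / (l + 1))\<^sup>2 > 0"
    by (simp add: add_pos_nonneg)
  thus ?thesis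
    unfolding coulomb_coeff_def using assms by (intro divide_pos_pos) auto
qed

lemma coulomb_wronskian_neighbour_pos:
  assumes l: "l > -1"
  shows "0 < coulomb_re (l + 1) \<eta> x * coulomb_re l \<eta> x
    + x * (coulomb_re_deriv (l + 1) \<eta> x * coulomb_re l \<eta> x
           - coulomb_re (l + 1) \<eta> x * coulomb_re_deriv l \<eta> x)"
proof (rule wronskian_pos[where L = "l + 1" and \<kappa> = "coulomb_coeff l \<eta>" and \<alpha> = "\<eta> / (l + 1)"])
  show "(2 * (l + 1) + 1) * coulomb_coeff l \<eta> = 1 + (\<eta> / (l + 1))\<^sup>2"
  proof -
    have "2 * (l + 1) + 1 = 2 * l + 3" "2 * l + 3 \<noteq> 0"
      using l by simp_all
    thus ?thesis
      unfolding coulomb_coeff_def by (metis nonzero_mult_div_cancel_left times_divide_eq_right)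
  qed
  show "coulomb_re l \<eta> x = 0 \<Longrightarrow> coulomb_re (l + 1) \<eta> x \<noteq> 0" for x
    using coulomb_phi_no_common_zero[OF l, of \<eta> "of_real x"] l
    by (simp add: coulomb_phi_of_real)
  show "x * coulomb_re_deriv (l + 1) \<eta> x
      = (2 * (l + 1) + 1) * (coulomb_re l \<eta> x - coulomb_re (l + 1) \<eta> x)
        - \<eta> / (l + 1) * x * coulomb_re (l + 1) \<eta> x" for x
    using coulomb_re_deriv_Suc[OF l, of x \<eta>] by simp
  show "coulomb_re_deriv l \<eta> x
      = \<eta> / (l + 1) * coulomb_re l \<eta> x - coulomb_coeff l \<eta> * x * coulomb_re (l + 1) \<eta> x" for x
    by (simp add: coulomb_re_deriv_def)
qed (use l in \<open>auto intro!: coulomb_re_has_derivative\<close>)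

text \<open>Put \<open>\<tau> = 1 + s x\<close> with \<open>s = \<eta> / ((l + 1) (l + 2))\<close>, and let \<open>p, q, r\<close> belong to \<open>l, l + 1,
  l + 2\<close>. The inequality is about the Wronskian \<open>(x \<tau> r)' p - x \<tau> r p'\<close>. Inserting the
  recurrence \<open>p = \<tau> q - K x\<^sup>2 r\<close> splits it into two terms: \<open>\<tau>\<^sup>2\<close> times the Wronskian of
  the neighbouring pair \<open>q, x r\<close>, and \<open>K (x r)\<^sup>2\<close>. The second has this simple form because
  \<open>\<tau> - x \<tau>' = 1\<close>.\<close>
lemma coulomb_wronskian_skip_pos:
  fixes l \<eta> x :: real
  defines "s \<equiv> \<eta> / ((l + 1) * (l + 2))"
  assumes l: "l > -1" and x: "1 + s * x \<noteq> 0"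
  shows "0 < ((1 + 2 * s * x) * coulomb_re (l + 2) \<eta> x
        + x * (1 + s * x) * coulomb_re_deriv (l + 2) \<eta> x) * coulomb_re l \<eta> x
      - x * (1 + s * x) * coulomb_re (l + 2) \<eta> x * coulomb_re_deriv l \<eta> x"
proof -
  define K where "K = coulomb_coeff (l + 1) \<eta> / (2 * l + 3)"
  define p q r where "p = coulomb_re l \<eta>" and "q = coulomb_re (l + 1) \<eta>"
    and "r = coulomb_re (l + 2) \<eta>"
  define p' q' r' where "p' = coulomb_re_deriv l \<eta>" and "q' = coulomb_re_deriv (l + 1) \<eta>"
    and "r' = coulomb_re_deriv (l + 2) \<eta>"
  note defs = p_def q_def r_def p'_def q'_def r'_def
  have "K > 0"
    using coulomb_coeff_pos[of "l + 1" \<eta>] l by (simp add: K_def)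
  have d: "(p has_real_derivative p' x) (at x)" "(q has_real_derivative q' x) (at x)"
      "(r has_real_derivative r' x) (at x)"
    unfolding defs using l by (auto intro!: coulomb_re_has_derivative)
  have p: "p y = (1 + s * y) * q y - K * y\<^sup>2 * r y" for y
    using coulomb_re_recurrence[OF l] by (simp add: defs s_def K_def)
  have p': "p' x = s * q x + (1 + s * x) * q' x - K * (2 * x * r x + x\<^sup>2 * r' x)"
  proof (rule DERIV_unique)
    show "((\<lambda>x. (1 + s * x) * q x - K * x\<^sup>2 * r x) has_real_derivative
        s * q x + (1 + s * x) * q' x - K * (2 * x * r x + x\<^sup>2 * r' x)) (at x)"
      by (auto intro!: derivative_eq_intros d simp: power2_eq_square algebra_simps)
    show "((\<lambda>x. (1 + s * x) * q x - K * x\<^sup>2 * r x) has_real_derivative p' x) (at x)"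
      using d(1) unfolding p[abs_def] .
  qed
  have "((1 + 2 * s * x) * r x + x * (1 + s * x) * r' x) * p x - x * (1 + s * x) * r x * p' x
      = (1 + s * x)\<^sup>2 * (r x * q x + x * (r' x * q x - r x * q' x)) + K * (x * r x)\<^sup>2"
    unfolding p p' by (simp add: power2_eq_square algebra_simps)
  also have "\<dots> > 0"
  proof -
    have "0 < r x * q x + x * (r' x * q x - r x * q' x)"
      using coulomb_wronskian_neighbour_pos[of "l + 1" \<eta> x] l by (simp add: defs add.assoc)
    hence "0 < (1 + s * x)\<^sup>2 * (r x * q x + x * (r' x * q x - r x * q' x))"
      using x by simp
    thus ?thesis
      using \<open>K > 0\<close> by (simp add: add_pos_nonneg)
  qed
  finally show ?thesis
    by (simp add: defs)
qed

section \<open>Interlacing of the zeros\<close>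

text \<open>If \<open>f\<close> had no zero between two zeros of \<open>g\<close>, the quotient \<open>k g / f\<close> would be strictly
  monotone there and vanish at both ends. One exceptional point \<open>c\<close> of the sign condition does not
  affect strict monotonicity; it covers the point where the recurrence degenerates.\<close>
lemma zero_between_zeros:
  fixes f g f' g' :: "real \<Rightarrow> real"
  assumes f: "\<And>x. (f has_real_derivative f' x) (at x)"
    and g: "\<And>x. (g has_real_derivative g' x) (at x)"
    and W: "\<And>x. x \<noteq> c \<Longrightarrow> 0 < k * (g' x * f x - g x * f' x)"
    and disjoint: "\<And>x. f x = 0 \<Longrightarrow> g x \<noteq> 0"
    and ab: "a < b" "g a = 0" "g b = 0"
  shows "\<exists>t\<in>{a<..<b}. f t = 0"
proof (rule ccontr)
  assume contra: "\<not> ?thesis"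
  have nz: "f t \<noteq> 0" if "t \<in> {a..b}" for t
    using contra disjoint[of t] ab that by (cases "t = a \<or> t = b") auto
  define h where "h = (\<lambda>x. k * g x / f x)"
  have h: "(h has_real_derivative k * (g' x * f x - g x * f' x) / (f x)\<^sup>2) (at x)"
    if "x \<in> {a..b}" for x
    unfolding h_def
    by (auto intro!: derivative_eq_intros f g simp: nz[OF that] power2_eq_square algebra_simps)
  have less: "h u < h v" if uv: "u < v" "a \<le> u" "v \<le> b" "c \<notin> {u<..<v}" for u v
  proof (rule DERIV_pos_imp_increasing_open[of u v h])
    show "\<exists>y. (h has_real_derivative y) (at x) \<and> 0 < y" if "u < x" "x < v" for x
      using h[of x] nz[of x] W[of x] uv that by fastforce
    show "continuous_on {u..v} h"
      using h uv by (intro DERIV_atLeastAtMost_imp_continuous_on) (meson atLeastAtMost_iff order_trans)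
  qed fact
  have "h a < h b"
  proof (cases "c \<in> {a<..<b}")
    case True
    thus ?thesis using less[of a c] less[of c b] by force
  next
    case False
    thus ?thesis using less[of a b] ab by auto
  qed
  thus False
    using ab by (simp add: h_def)
qed

text \<open>The condition on the Wronskian is symmetric in \<open>f\<close> and \<open>g\<close> up to the sign of \<open>k\<close>, so each
  function has a zero between any two zeros of the other. Uniqueness follows: two zeros of one
  function between consecutive zeros of the other would enclose a further zero of the latter.\<close>
lemma interlaced_zerosI:
  fixes f g f' g' :: "real \<Rightarrow> real"
  assumes F: "\<And>x. F (of_real x) = of_real (f x)" and G: "\<And>x. G (of_real x) = of_real (g x)"
    and f: "\<And>x. (f has_real_derivative f' x) (at x)"
    and g: "\<And>x. (g has_real_derivative g' x) (at x)"
    and W: "\<And>x. x \<noteq> c \<Longrightarrow> 0 < k * (g' x * f x - g x * f' x)"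
    and disjoint: "\<And>z. F z = 0 \<Longrightarrow> G z \<noteq> 0"
  shows "interlaced_zeros F G"
proof -
  have d: "f x = 0 \<Longrightarrow> g x \<noteq> 0" for x
    using disjoint[of "of_real x"] by (simp add: F G)
  have f_between: "\<exists>t\<in>{a<..<b}. f t = 0" if "a < b" "g a = 0" "g b = 0" for a b
    using zero_between_zeros[OF f g W d that] .
  have g_between: "\<exists>t\<in>{a<..<b}. g t = 0" if ab: "a < b" "f a = 0" "f b = 0" for a b
  proof -
    have "0 < - k * (f' x * g x - f x * g' x)" if "x \<noteq> c" for x
      using W[OF that] by (simp add: algebra_simps)
    thus ?thesis
      using zero_between_zeros[OF g f, of c "- k" a b] d ab by blast
  qed
  have "\<exists>!t. t \<in> {a<..<b} \<and> g t = 0"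
    if "a < b" "f a = 0" "f b = 0" "\<And>t. t \<in> {a<..<b} \<Longrightarrow> f t \<noteq> 0" for a b
  proof -
    have "s = t" if "s \<in> {a<..<b}" "t \<in> {a<..<b}" "g s = 0" "g t = 0" for s t
      using f_between[of s t] f_between[of t s] that \<open>\<And>t. t \<in> {a<..<b} \<Longrightarrow> f t \<noteq> 0\<close>
      by (cases s t rule: linorder_cases) force+
    thus ?thesis using g_between[of a b] that by blast
  qed
  moreover have "\<exists>!t. t \<in> {a<..<b} \<and> f t = 0"
    if "a < b" "g a = 0" "g b = 0" "\<And>t. t \<in> {a<..<b} \<Longrightarrow> g t \<noteq> 0" for a b
  proof -
    have "s = t" if "s \<in> {a<..<b}" "t \<in> {a<..<b}" "f s = 0" "f t = 0" for s t
      using g_between[of s t] g_between[of t s] that \<open>\<And>t. t \<in> {a<..<b} \<Longrightarrow> g t \<noteq> 0\<close>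
      by (cases s t rule: linorder_cases) force+
    thus ?thesis using f_between[of a b] that by blast
  qed
  ultimately show ?thesis
    using disjoint by (auto simp: interlaced_zeros_def consecutive_zeros_def zeros_def F G)
qed

lemma divide_root_entire:
  assumes f: "f holomorphic_on UNIV" and r: "f r = 0"
  shows "divide_root f r z = (if z = r then deriv f r else f z / (z - r))"
    and "divide_root f r holomorphic_on UNIV"
    and "(z - r) * divide_root f r z = f z"
proof -
  have eq: "divide_root f r z = (if z = r then deriv f r else f z / (z - r))" for z
  proof (cases "z = r")
    case True
    have "f field_differentiable at r"
      using f by (auto simp: holomorphic_on_def)
    hence "((\<lambda>z. (f z - f r) / (z - r)) \<longlongrightarrow> deriv f r) (at r)"
      by (simp add: field_differentiable_derivI has_field_derivative_iff flip: DERIV_deriv_iff_field_differentiable)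
    thus ?thesis
      unfolding divide_root_def using True r by (auto intro!: remove_sings_eqI)
  next
    case False
    have "(\<lambda>x. f x / (x - r)) holomorphic_on - {r}"
      using f by (auto intro!: holomorphic_intros intro: holomorphic_on_subset)
    hence "(\<lambda>x. f x / (x - r)) analytic_on {z}"
      using False by (auto simp: analytic_on_open[symmetric] open_Compl intro: analytic_on_subset)
    thus ?thesis
      unfolding divide_root_def using False by simp
  qed
  show "divide_root f r z = (if z = r then deriv f r else f z / (z - r))"
    by (rule eq)
  have "divide_root f r = (\<lambda>z. if z = r then deriv f r else (f z - f r) / (z - r))"
    by (auto simp: eq r)
  thus "divide_root f r holomorphic_on UNIV"
    using pole_lemma_open[OF f open_UNIV, of r] by simp
  show "(z - r) * divide_root f r z = f z"
    by (simp add: eq r)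
qed

theorem theorem6p1:
  fixes \<eta> l \<rho> :: real
  assumes "\<eta> \<noteq> 0" and "l > -1"
  defines "\<rho> \<equiv> - ((l + 1) * (l + 2)) / \<eta>"
  shows "(of_real \<rho> \<notin> zeros (coulomb_phi l \<eta>) \<longrightarrow>
            interlaced_zeros (coulomb_phi l \<eta>)
              (\<lambda>x. x * (x - of_real \<rho>) * coulomb_phi (l + 2) \<eta> x)) \<and>
         (of_real \<rho> \<in> zeros (coulomb_phi l \<eta>) \<longrightarrow>
            interlaced_zeros (divide_root (coulomb_phi l \<eta>) (of_real \<rho>))
              (\<lambda>x. x * coulomb_phi (l + 2) \<eta> x))"
proof -
  note l = \<open>l > -1\<close>
  define s where "s = \<eta> / ((l + 1) * (l + 2))"
  have s: "s \<noteq> 0" "s * \<rho> = -1"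
    using assms by (simp_all add: \<rho>_def s_def)
  have \<tau>: "1 + s * x = s * (x - \<rho>)" for x
    using s(2) by (simp add: algebra_simps)
  define p r where "p = coulomb_re l \<eta>" and "r = coulomb_re (l + 2) \<eta>"
  define p' r' where "p' = coulomb_re_deriv l \<eta>" and "r' = coulomb_re_deriv (l + 2) \<eta>"
  have dp: "(p has_real_derivative p' x) (at x)" and dr: "(r has_real_derivative r' x) (at x)" for x
    unfolding p_def p'_def r_def r'_def using l by (auto intro!: coulomb_re_has_derivative)
  have phi_real: "coulomb_phi l \<eta> (of_real x) = of_real (p x)"
      "coulomb_phi (l + 2) \<eta> (of_real x) = of_real (r x)" for x
    using l by (simp_all add: p_def r_def coulomb_phi_of_real)
  define g where "g = (\<lambda>x. x * (x - \<rho>) * r x)"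
  define g' where "g' = (\<lambda>x. (2 * x - \<rho>) * r x + x * (x - \<rho>) * r' x)"
  have dg: "(g has_real_derivative g' x) (at x)" for x
    unfolding g_def g'_def by (auto intro!: derivative_eq_intros dr simp: algebra_simps)
  have W: "0 < s * (g' x * p x - g x * p' x)" if x: "x \<noteq> \<rho>" for x
  proof -
    have two: "1 + 2 * s * x = s * (2 * x - \<rho>)"
      using s(2) by (simp add: algebra_simps)
    have "1 + s * x \<noteq> 0"
      unfolding \<tau> using s(1) x by simp
    from coulomb_wronskian_skip_pos[OF l, of \<eta> x, folded s_def, OF this]
    have "0 < (s * (2 * x - \<rho>) * r x + x * (s * (x - \<rho>)) * r' x) * p x
        - x * (s * (x - \<rho>)) * r x * p' x"
      unfolding \<tau> two by (simp add: p_def r_def p'_def r'_def)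
    also have "\<dots> = s * (g' x * p x - g x * p' x)"
      by (simp add: g_def g'_def algebra_simps)
    finally show ?thesis .
  qed
  have no_common: "z * coulomb_phi (l + 2) \<eta> z \<noteq> 0"
    if z: "coulomb_phi l \<eta> z = 0" "z \<noteq> of_real \<rho>" for z
  proof
    assume "z * coulomb_phi (l + 2) \<eta> z = 0"
    moreover have "z \<noteq> 0"
      using z(1) by auto
    ultimately have "(1 + of_real s * z) * coulomb_phi (l + 1) \<eta> z = 0"
      using coulomb_phi_recurrence[OF l, of \<eta> z] z(1) by (simp add: s_def)
    moreover have "1 + of_real s * z = of_real s * (z - of_real \<rho>)"
      using s(2) by (simp add: algebra_simps flip: of_real_mult)
    ultimately show False
      using coulomb_phi_no_common_zero[OF l z(1)] z(2) s(1) by simp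
  qed
  show ?thesis
  proof (intro conjI impI)
    assume "of_real \<rho> \<notin> zeros (coulomb_phi l \<eta>)"
    show "interlaced_zeros (coulomb_phi l \<eta>)
        (\<lambda>x. x * (x - of_real \<rho>) * coulomb_phi (l + 2) \<eta> x)"
    proof (rule interlaced_zerosI[OF _ _ dp dg W])
      fix z :: complex assume "coulomb_phi l \<eta> z = 0"
      thus "z * (z - of_real \<rho>) * coulomb_phi (l + 2) \<eta> z \<noteq> 0"
        using no_common[of z] \<open>of_real \<rho> \<notin> zeros (coulomb_phi l \<eta>)\<close> by (auto simp: zeros_def)
    qed (simp_all add: phi_real g_def)
  next
    assume "of_real \<rho> \<in> zeros (coulomb_phi l \<eta>)"
    hence root: "coulomb_phi l \<eta> (of_real \<rho>) = 0"
      by (simp add: zeros_def)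
    define D where "D = divide_root (coulomb_phi l \<eta>) (of_real \<rho>)"
    note D = divide_root_entire[OF holomorphic_coulomb_phi root, folded D_def]
    have D_\<rho>: "D (of_real \<rho>) = of_real (p' \<rho>)"
      using D(1) DERIV_imp_deriv[OF coulomb_phi_has_derivative[OF l]] coulomb_phi_deriv_of_real[OF l]
      by (simp add: p'_def)
    define f where "f = (\<lambda>x. Re (D (of_real x)))"
    have f: "D (of_real x) = of_real (f x)" for x
    proof (cases "x = \<rho>")
      case True
      thus ?thesis by (simp add: f_def D_\<rho>)
    next
      case False
      hence "D (of_real x) = of_real (p x / (x - \<rho>))"
        using D(1)[of "of_real x"] by (simp add: phi_real)
      thus ?thesis by (simp add: f_def)
    qed
    define f' where "f' = (\<lambda>x. Re (deriv D (of_real x)))"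
    have df: "(f has_real_derivative f' x) (at x)" for x
    proof -
      have "(D has_field_derivative deriv D (of_real x)) (at (of_real x))"
        using D(2) by (intro holomorphic_derivI[of _ UNIV]) auto
      thus ?thesis
        unfolding f_def f'_def
        by (intro has_field_derivative_Re has_vector_derivative_real_field)
    qed
    have pf: "p x = (x - \<rho>) * f x" for x
    proof -
      have "complex_of_real (p x) = of_real ((x - \<rho>) * f x)"
        using D(3)[of "of_real x"] by (simp add: f phi_real)
      thus ?thesis
        unfolding of_real_eq_iff .
    qed
    have pf': "p' x = f x + (x - \<rho>) * f' x" for x
    proof (rule DERIV_unique)
      show "((\<lambda>x. (x - \<rho>) * f x) has_real_derivative f x + (x - \<rho>) * f' x) (at x)"
        by (auto intro!: derivative_eq_intros df)
      show "((\<lambda>x. (x - \<rho>) * f x) has_real_derivative p' x) (at x)"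
        using dp[of x] unfolding pf[abs_def] .
    qed
    \<comment> \<open>\<open>\<rho>\<close> is a simple zero: there the derivative is a nonzero multiple of the function for
      \<open>l + 1\<close>. So \<open>D\<close> has no zero at \<open>\<rho>\<close>, and the recurrence excludes all other common zeros.\<close>
    have "p' \<rho> \<noteq> 0"
    proof -
      have "coulomb_re l \<eta> \<rho> = 0"
        using pf[of \<rho>] by (simp add: p_def)
      moreover have "coulomb_re (l + 1) \<eta> \<rho> \<noteq> 0"
        using coulomb_phi_no_common_zero[OF l root] l by (simp add: coulomb_phi_of_real)
      moreover have "\<rho> \<noteq> 0"
        using s(2) by auto
      ultimately show ?thesis
        using coulomb_coeff_pos[OF l, of \<eta>] by (simp add: p'_def coulomb_re_deriv_def)
    qed
    show "interlaced_zeros D (\<lambda>x. x * coulomb_phi (l + 2) \<eta> x)"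
    proof (rule interlaced_zerosI[OF f _ df])
      show "((\<lambda>x. x * r x) has_real_derivative r x + x * r' x) (at x)" for x
        by (auto intro!: derivative_eq_intros dr)
      \<comment> \<open>Dividing both functions by \<open>x - \<rho>\<close> divides the Wronskian by its square.\<close>
      show "0 < s * ((r x + x * r' x) * f x - x * r x * f' x)" if "x \<noteq> \<rho>" for x
      proof -
        have "s * (g' x * p x - g x * p' x)
            = (x - \<rho>)\<^sup>2 * (s * ((r x + x * r' x) * f x - x * r x * f' x))"
          unfolding g_def g'_def pf pf' by (simp add: power2_eq_square algebra_simps)
        moreover have "(x - \<rho>)\<^sup>2 > 0"
          using that by simp
        ultimately show ?thesis
          using W[OF that] by (metis zero_less_mult_pos)
      qed
      fix z :: complex assume Dz: "D z = 0"
      have "z \<noteq> of_real \<rho>"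
        using Dz D_\<rho> \<open>p' \<rho> \<noteq> 0\<close> by auto
      moreover have "coulomb_phi l \<eta> z = 0"
        using D(3)[of z] Dz by simp
      ultimately show "z * coulomb_phi (l + 2) \<eta> z \<noteq> 0"
        using no_common[of z] by simp
    qed (simp add: phi_real)
  qed
qed

end
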